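(* Let $n,m,p,q\ge1$ and $r\ge0$ be integers, $l=n+(r+1)q$, $h\ge0$, $T\ge0$, $\epsilon_r\ge0$, $t_0\in\mathbb{R}$, and consider the system $$\dot x(t)=Ax(t)+B_uu(t-h)+B_\omega\omega(t),\qquad y(t)=C_xx(t)+D_\omega\omega(t),\qquad t\ge t_0,$$ with $x(t)\in\mathbb{R}^n$, $u(t)\in\mathbb{R}^m$, $\omega(t)\in\mathbb{R}^q$, $y(t)\in\mathbb{R}^p$ and real matrices of appropriate dimensions. Assume that $\omega:\mathbb{R}\to\mathbb{R}^q$ is $(r+1)$-times continuously differentiable with $\|\omega^{(r+1)}(s)\|\le\epsilon_r$ for all $s\in\mathbb{R}$, that $u:[t_0-h,\infty)\to\mathbb{R}^m$ is piecewise constant (finitely many jumps in each bounded interval), and that $(\bar A,\bar C)$ is observable. Let $\mathcal{D}=\{z\in\mathbb{C}: N+zM+z^*M^T\prec0\}$ be a bounded set, where $N=N^T$ and $M$ are real square matrices of the same size. Suppose there exist $\alpha>0$, $\delta>0$, a symmetric positive definite matrix $P\in\mathbb{R}^{l\times l}$ and a matrix $Y\in\mathbb{R}^{l\times p}$ such that $$\begin{bmatrix}P\bar A+\bar A^TP-Y\bar C-\bar C^TY^T+2\delta P & P\bar B_\omega\\ \bar B_\omega^TP & -I_q\end{bmatrix}\preceq0,$$ $$P-\alpha K(T)^TK(T)\succeq0,$$ $$N\otimes P+M\otimes(P\bar A-Y\bar C)+M^T\otimes(P\bar A-Y\bar C)^T\prec0.$$ Let $L=P^{-1}Y$ and let $e_\eta:[t_0,\infty)\to\mathbb{R}^l$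 be the solution, for any initial state $e_\eta(t_0)\in\mathbb{R}^l$, of $$\dot e_\eta(t)=(\bar A-L\bar C)e_\eta(t)+\bar B_\omega\,\omega^{(r+1)}(t),\qquad \mathcal{O}_e(t)=K(T)e_\eta(t).$$ Then $\mathcal{O}_e(t)$ exponentially approaches, with decay rate $\delta$, the ball $\{v\in\mathbb{R}^n:\|v\|\le\epsilon_r\sqrt{\tfrac{1}{2\alpha\delta}}\}$; that is, for every $e_\eta(t_0)$ there is a constant $c\ge0$ such that $$\|\mathcal{O}_e(t)\|\le\epsilon_r\sqrt{\frac{1}{2\alpha\delta}}+c\,e^{-\delta(t-t_0)}\qquad\text{for all }t\ge t_0.$$ Moreover, every eigenvalue of $\bar A-L\bar C$ belongs to $\mathcal{D}$.
   Context: Norms are Euclidean; $\prec,\preceq,\succeq$ denote the (semi)definite order on symmetric/Hermitian matrices; $z^*$ is the complex conjugate; $\otimes$ is the Kronecker product. $\Phi(T)=e^{AT}$. For $i=0,\dots,r$: $\Gamma_{\omega,i}(T)=\sum_{j=0}^\infty\frac{(i+1)!}{(i+1+j)!}A^jT^j$, and $\boldsymbol{\Gamma}_\omega(T)=\big[T\Gamma_{\omega,0}(T)B_\omega,\dots,\frac{T^{r+1}}{(r+1)!}\Gamma_{\omega,r}(T)B_\omega\big]\in\mathbb{R}^{n\times(r+1)q}$, with $i$-th block $\frac{T^{i+1}}{(i+1)!}\Gamma_{\omega,i}(T)B_\omega$. Augmented matrices: $$\bar A=\begin{bmatrix}A&B_\omega\Pi\\0&\Psi\end{bmatrix},\quad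 \Psi=\begin{bmatrix}0_{rq\times q}&I_{rq}\\0_{q\times q}&0_{q\times rq}\end{bmatrix},\quad \Pi=\begin{bmatrix}I_q&0_{q\times rq}\end{bmatrix},$$ $$\bar C=\begin{bmatrix}C_x&D_\omega&0_{p\times rq}\end{bmatrix},\quad \bar B_\omega=\begin{bmatrix}0_{q\times(n+rq)}&I_q\end{bmatrix}^T,\quad K(T)=\begin{bmatrix}\Phi(T)&\boldsymbol{\Gamma}_\omega(T)\end{bmatrix}.$$ (For $r=0$, $\Psi=0_{q\times q}$ and $\Pi=I_q$.) Here $e_\eta=\eta-\hat\eta$ is the estimation error of the observer $\dot{\hat\eta}(t)=(\bar A-L\bar C)\hat\eta(t)+\bar B_uu(t-h)+Ly(t)$, with $\bar B_u=\begin{bmatrix}B_u\\0_{(r+1)q\times m}\end{bmatrix}$, for the augmented state $\eta(t)=[x(t)^T,\omega(t)^T,\dot\omega(t)^T,\dots,\omega^{(r)}(t)^T]^T\in\mathbb{R}^l$. *)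

theory Defs
  imports
    "HOL-Analysis.Derivative"
    "Jordan_Normal_Form.Schur_Decomposition"
begin

subsection \<open>Matrices\<close>

definition append_cols :: "'a :: zero mat \<Rightarrow> 'a mat \<Rightarrow> 'a mat" where
  "append_cols A B = four_block_mat A B (0\<^sub>m 0 (dim_col A)) (0\<^sub>m 0 (dim_col B))"

definition kronecker :: "'a :: times mat \<Rightarrow> 'a mat \<Rightarrow> 'a mat" where
  "kronecker A B = mat (dim_row A * dim_row B) (dim_col A * dim_col B)
     (\<lambda>(i, j). A $$ (i div dim_row B, j div dim_col B) * B $$ (i mod dim_row B, j mod dim_col B))"

text \<open>Over \<open>real\<close> the adjoint is the transpose and \<open>\<bullet>c\<close> the ordinary scalar product. Over
  \<open>complex\<close>, \<open>0 \<le> z\<close> and \<open>0 < z\<close> mean that \<open>z\<close> is a nonnegative, respectively positive, real.\<close>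

definition pos_semidef :: "'a :: conjugatable_ordered_field mat \<Rightarrow> bool" where
  "pos_semidef A \<longleftrightarrow> square_mat A \<and> mat_adjoint A = A
     \<and> (\<forall>v\<in>carrier_vec (dim_row A). 0 \<le> (A *\<^sub>v v) \<bullet>c v)"

definition pos_def :: "'a :: conjugatable_ordered_field mat \<Rightarrow> bool" where
  "pos_def A \<longleftrightarrow> square_mat A \<and> mat_adjoint A = A
     \<and> (\<forall>v\<in>carrier_vec (dim_row A). v \<noteq> 0\<^sub>v (dim_row A) \<longrightarrow> 0 < (A *\<^sub>v v) \<bullet>c v)"

abbreviation neg_semidef :: "'a :: conjugatable_ordered_field mat \<Rightarrow> bool" where
  "neg_semidef A \<equiv> pos_semidef (- A)"

abbreviation neg_def :: "'a :: conjugatable_ordered_field mat \<Rightarrow> bool" where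
  "neg_def A \<equiv> pos_def (- A)"

abbreviation complex_mat :: "real mat \<Rightarrow> complex mat" where
  "complex_mat \<equiv> map_mat complex_of_real"

definition lmi_region :: "real mat \<Rightarrow> real mat \<Rightarrow> complex set" where
  "lmi_region N M =
     {z. neg_def (complex_mat N + z \<cdot>\<^sub>m complex_mat M + cnj z \<cdot>\<^sub>m (complex_mat M)\<^sup>T)}"

definition mat_suminf :: "nat \<Rightarrow> nat \<Rightarrow> (nat \<Rightarrow> real mat) \<Rightarrow> real mat" where
  "mat_suminf nr nc F = mat nr nc (\<lambda>ij. \<Sum>k. F k $$ ij)"

definition mat_exp :: "real mat \<Rightarrow> real mat" where
  "mat_exp X = mat_suminf (dim_row X) (dim_row X) (\<lambda>k. (1 / fact k) \<cdot>\<^sub>m X ^\<^sub>m k)"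

subsection \<open>Vector-valued functions of time\<close>

definition euclid_norm :: "real vec \<Rightarrow> real" where
  "euclid_norm v = sqrt (v \<bullet> v)"

text \<open>Vectors of type \<open>real vec\<close> carry their dimension as a value and do not form a normed space,
  so derivatives and continuity are stated for each coordinate.\<close>

definition has_vec_derivative :: "(real \<Rightarrow> real vec) \<Rightarrow> real vec \<Rightarrow> real filter \<Rightarrow> bool" where
  "has_vec_derivative f d F \<longleftrightarrow>
     (\<forall>i<dim_vec d. ((\<lambda>s. f s $ i) has_real_derivative d $ i) F)"

definition vec_continuous_on :: "nat \<Rightarrow> real set \<Rightarrow> (real \<Rightarrow> real vec) \<Rightarrow> bool" where
  "vec_continuous_on n S f \<longleftrightarrow> (\<forall>i<n. continuous_on S (\<lambda>s. f s $ i))"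

definition vec_deriv :: "nat \<Rightarrow> nat \<Rightarrow> (real \<Rightarrow> real vec) \<Rightarrow> real \<Rightarrow> real vec" where
  "vec_deriv n k f t = vec n (\<lambda>i. (deriv ^^ k) (\<lambda>s. f s $ i) t)"

definition continuously_differentiable :: "nat \<Rightarrow> nat \<Rightarrow> (real \<Rightarrow> real vec) \<Rightarrow> bool" where
  "continuously_differentiable n k f \<longleftrightarrow>
     (\<forall>j<k. \<forall>t. has_vec_derivative (vec_deriv n j f) (vec_deriv n (Suc j) f t) (at t))
     \<and> vec_continuous_on n UNIV (vec_deriv n k f)"

definition locally_finite_set :: "real set \<Rightarrow> bool" where
  "locally_finite_set J \<longleftrightarrow> (\<forall>a b. finite (J \<inter> {a..b}))"

text \<open>The value at a jump itself is unconstrained.\<close>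

definition piecewise_constant_from :: "real \<Rightarrow> (real \<Rightarrow> 'a) \<Rightarrow> bool" where
  "piecewise_constant_from a u \<longleftrightarrow>
     (\<exists>J. locally_finite_set J \<and> (\<forall>s\<ge>a. \<forall>t\<ge>s. J \<inter> {s..t} = {} \<longrightarrow> u s = u t))"

subsection \<open>Linear systems\<close>

text \<open>The input is only piecewise constant, so the state is continuous and satisfies the
  differential equation off a locally finite set of times.\<close>

definition plant_state ::
  "real mat \<Rightarrow> real mat \<Rightarrow> real mat \<Rightarrow> real \<Rightarrow> real
     \<Rightarrow> (real \<Rightarrow> real vec) \<Rightarrow> (real \<Rightarrow> real vec) \<Rightarrow> (real \<Rightarrow> real vec) \<Rightarrow> bool" where
  "plant_state A Bu Bw h t0 u w x \<longleftrightarrow>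
     (\<forall>t\<ge>t0. x t \<in> carrier_vec (dim_row A)) \<and> vec_continuous_on (dim_row A) {t0..} x
     \<and> (\<exists>J. locally_finite_set J \<and>
          (\<forall>t\<in>{t0..} - J. has_vec_derivative x
             (A *\<^sub>v x t + Bu *\<^sub>v u (t - h) + Bw *\<^sub>v w t) (at t within {t0..})))"

definition ode_solution ::
  "nat \<Rightarrow> real \<Rightarrow> (real \<Rightarrow> real vec \<Rightarrow> real vec) \<Rightarrow> (real \<Rightarrow> real vec) \<Rightarrow> bool" where
  "ode_solution n t0 f x \<longleftrightarrow>
     (\<forall>t\<ge>t0. x t \<in> carrier_vec n \<and> has_vec_derivative x (f t (x t)) (at t within {t0..}))"

definition observable :: "real mat \<Rightarrow> real mat \<Rightarrow> bool" where
  "observable A C \<longleftrightarrow>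
     (\<forall>x1 x2. ode_solution (dim_row A) 0 (\<lambda>t x. A *\<^sub>v x) x1
        \<longrightarrow> ode_solution (dim_row A) 0 (\<lambda>t x. A *\<^sub>v x) x2
        \<longrightarrow> (\<forall>t\<ge>0. C *\<^sub>v x1 t = C *\<^sub>v x2 t) \<longrightarrow> x1 0 = x2 0)"

subsection \<open>Augmented system and prediction matrices\<close>

definition aug_Psi :: "nat \<Rightarrow> nat \<Rightarrow> real mat" where
  "aug_Psi q r = four_block_mat (0\<^sub>m (r * q) q) (1\<^sub>m (r * q)) (0\<^sub>m q q) (0\<^sub>m q (r * q))"

definition aug_Pi :: "nat \<Rightarrow> nat \<Rightarrow> real mat" where
  "aug_Pi q r = append_cols (1\<^sub>m q) (0\<^sub>m q (r * q))"

definition aug_A :: "nat \<Rightarrow> nat \<Rightarrow> nat \<Rightarrow> real mat \<Rightarrow> real mat \<Rightarrow> real mat" where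
  "aug_A n q r A Bw = four_block_mat A (Bw * aug_Pi q r) (0\<^sub>m ((r + 1) * q) n) (aug_Psi q r)"

definition aug_C :: "nat \<Rightarrow> nat \<Rightarrow> nat \<Rightarrow> real mat \<Rightarrow> real mat \<Rightarrow> real mat" where
  "aug_C p q r Cx Dw = append_cols (append_cols Cx Dw) (0\<^sub>m p (r * q))"

definition aug_B :: "nat \<Rightarrow> nat \<Rightarrow> nat \<Rightarrow> real mat" where
  "aug_B n q r = (append_cols (0\<^sub>m q (n + r * q)) (1\<^sub>m q))\<^sup>T"

definition Phi :: "real mat \<Rightarrow> real \<Rightarrow> real mat" where
  "Phi A T = mat_exp (T \<cdot>\<^sub>m A)"

definition Gamma_mat :: "nat \<Rightarrow> real mat \<Rightarrow> nat \<Rightarrow> real \<Rightarrow> real mat" where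
  "Gamma_mat n A i T =
     mat_suminf n n (\<lambda>j. (fact (i + 1) / fact (i + 1 + j) * T ^ j) \<cdot>\<^sub>m A ^\<^sub>m j)"

definition Gamma_block :: "nat \<Rightarrow> real mat \<Rightarrow> real mat \<Rightarrow> nat \<Rightarrow> real \<Rightarrow> real mat" where
  "Gamma_block n A Bw i T = (T ^ (i + 1) / fact (i + 1)) \<cdot>\<^sub>m (Gamma_mat n A i T * Bw)"

definition Gamma_row :: "nat \<Rightarrow> nat \<Rightarrow> nat \<Rightarrow> real mat \<Rightarrow> real mat \<Rightarrow> real \<Rightarrow> real mat" where
  "Gamma_row n q r A Bw T =
     mat n ((r + 1) * q) (\<lambda>(a, b). Gamma_block n A Bw (b div q) T $$ (a, b mod q))"

definition K_mat :: "nat \<Rightarrow> nat \<Rightarrow> nat \<Rightarrow> real mat \<Rightarrow> real mat \<Rightarrow> real \<Rightarrow> real mat" where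
  "K_mat n q r A Bw T = append_cols (Phi A T) (Gamma_row n q r A Bw T)"

end

theory Submission
  imports Defs
begin

text \<open>
  With \<open>Y = P L\<close>, evaluating the first matrix inequality at the stacked vector
  \<open>(e, w)\<close>, where \<open>w\<close> is the \<open>(r+1)\<close>-st derivative of the disturbance, says that
  \<open>V = e\<^sup>T P e\<close> satisfies \<open>V' + 2 \<delta> V \<le> |w|\<^sup>2 \<le> eps\<^sup>2\<close> along every error trajectory. Hence
  \<open>V(t) \<le> eps\<^sup>2 / (2 \<delta>) + V(t0) exp(-2 \<delta> (t - t0))\<close>, and the second inequality bounds
  \<open>\<alpha> |K e|\<^sup>2\<close> by \<open>V\<close>. For the spectral claim, let \<open>v\<close> be an eigenvector of the closed loop for
  \<open>z\<close> and evaluate the Hermitian form of the Kronecker inequality at \<open>a \<otimes> v\<close>: since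
  \<open>P (Abar - L Cbar) v = z P v\<close>, it factors as \<open>v\<^sup>* P v\<close> times the form of
  \<open>N + z M + z\<^sup>* M\<^sup>T\<close> at \<open>a\<close>.
\<close>

unbundle no vec_syntax and no inner_syntax

section \<open>Adjoints and bilinear forms in coordinates\<close>

lemma mat_adjoint_index:
  assumes "i < dim_col A" "j < dim_row A"
  shows "mat_adjoint A $$ (i, j) = conjugate (A $$ (j, i))"
  using assms unfolding mat_adjoint_def by (simp add: mat_of_rows_index)

lemma mat_adjoint_dims [simp]:
  "dim_row (mat_adjoint A) = dim_col A" "dim_col (mat_adjoint A) = dim_row A"
  unfolding mat_adjoint_def by simp_all

lemma hermitian_index:
  assumes "A \<in> carrier_mat n n" "mat_adjoint A = A" "i < n" "j < n"
  shows "A $$ (i, j) = conjugate (A $$ (j, i))"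
  using mat_adjoint_index[of i A j] assms by auto

lemma symmetric_if_hermitian_real:
  fixes A :: "real mat"
  assumes "A \<in> carrier_mat n n" "mat_adjoint A = A"
  shows "A\<^sup>T = A"
  using assms hermitian_index[OF assms] by (intro eq_matI) auto

lemma smult_mat_mult_vec:
  fixes A :: "'a :: comm_semiring_0 mat"
  assumes "dim_vec v = dim_col A"
  shows "(k \<cdot>\<^sub>m A) *\<^sub>v v = k \<cdot>\<^sub>v (A *\<^sub>v v)"
  using assms by (intro eq_vecI) auto

text \<open>In this double-sum form, real and imaginary parts as well as time derivatives can be
  taken term by term.\<close>

lemma mult_mat_vec_scalar_prod_sum:
  assumes "A \<in> carrier_mat n m" "x \<in> carrier_vec m" "y \<in> carrier_vec n"
  shows "(A *\<^sub>v x) \<bullet> y = (\<Sum>i<n. \<Sum>j<m. A $$ (i, j) * x $ j * y $ i)"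
  using assms by (simp add: scalar_prod_def sum_distrib_right atLeast0LessThan)

subsection \<open>Hermitian forms and Kronecker products\<close>

text \<open>The order on \<open>complex\<close> compares real parts at equal imaginary parts, so
  \<open>c\<close> is a positive real and dividing by it preserves positivity.\<close>

lemma complex_mult_pos_cancel:
  fixes c d :: complex
  assumes "0 < c * d" "0 < c"
  shows "0 < d"
proof -
  have c: "Im c = 0" "Re c > 0" using assms(2) by (auto simp: less_complex_def)
  then show ?thesis using assms(1) by (auto simp: less_complex_def zero_less_mult_iff)
qed

text \<open>For \<open>v = a + i b\<close> and \<open>G\<close> real symmetric, the form at
  \<open>v\<close> is the sum of the real forms at \<open>a\<close> and at \<open>b\<close>, one of
  which is nonzero. This makes the real matrix inequalities applicable to complex
  eigenvectors.\<close>

lemma pos_def_complex_mat: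
  assumes "pos_def G"
  shows "pos_def (complex_mat G)"
proof -
  define n where "n = dim_row G"
  have G: "G \<in> carrier_mat n n" "mat_adjoint G = G"
    using assms unfolding pos_def_def n_def by (auto simp: square_mat.simps)
  have sym: "G $$ (i, j) = G $$ (j, i)" if "i < n" "j < n" for i j
    using hermitian_index[OF G that] by simp
  have adj: "mat_adjoint (complex_mat G) = complex_mat G"
    using G sym by (intro eq_matI) (auto simp: mat_adjoint_index)
  have "0 < (complex_mat G *\<^sub>v v) \<bullet>c v" if v: "v \<in> carrier_vec n" "v \<noteq> 0\<^sub>v n" for v
  proof -
    define a b where "a = map_vec Re v" and "b = map_vec Im v"
    have ab: "a \<in> carrier_vec n" "b \<in> carrier_vec n" using v by (auto simp: a_def b_def)
    have exp: "(complex_mat G *\<^sub>v v) \<bullet>c v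
        = (\<Sum>i<n. \<Sum>j<n. of_real (G $$ (i, j)) * v $ j * cnj (v $ i))"
      using G v by (subst mult_mat_vec_scalar_prod_sum[of _ n n]) auto
    have vi: "v $ i = Complex (a $ i) (b $ i)" if "i < n" for i
      using v that by (simp add: a_def b_def)
    have "Re ((complex_mat G *\<^sub>v v) \<bullet>c v) = (G *\<^sub>v a) \<bullet> a + (G *\<^sub>v b) \<bullet> b"
      unfolding exp mult_mat_vec_scalar_prod_sum[OF G(1) ab(1) ab(1)]
        mult_mat_vec_scalar_prod_sum[OF G(1) ab(2) ab(2)] sum.distrib[symmetric] Re_sum
      by (intro sum.cong refl) (simp add: vi algebra_simps)
    moreover have "(G *\<^sub>v a) \<bullet> a + (G *\<^sub>v b) \<bullet> b > 0"
    proof -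
      have pos: "(G *\<^sub>v c) \<bullet> c > 0" if "c \<in> carrier_vec n" "c \<noteq> 0\<^sub>v n" for c
        using assms that unfolding pos_def_def n_def by auto
      have nonneg: "(G *\<^sub>v c) \<bullet> c \<ge> 0" if "c \<in> carrier_vec n" for c
        using pos[of c] that G by (cases "c = 0\<^sub>v n") auto
      have "a \<noteq> 0\<^sub>v n \<or> b \<noteq> 0\<^sub>v n"
      proof (rule ccontr)
        assume *: "\<not> ?thesis"
        have "v $ i = 0" if "i < n" for i
        proof -
          have "a $ i = 0" "b $ i = 0" using * that by auto
          then show ?thesis using v that by (simp add: a_def b_def complex_eq_iff)
        qed
        then have "v = 0\<^sub>v n" using v by (intro eq_vecI) auto
        then show False using v by simp
      qed
      then show ?thesis using pos nonneg ab by (metis add_pos_nonneg add_nonneg_pos)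
    qed
    moreover have "Im ((complex_mat G *\<^sub>v v) \<bullet>c v) = 0"
    proof -
      have "Im ((complex_mat G *\<^sub>v v) \<bullet>c v)
          = (\<Sum>i<n. \<Sum>j<n. G $$ (i, j) * b $ j * a $ i)
            - (\<Sum>i<n. \<Sum>j<n. G $$ (i, j) * a $ j * b $ i)"
        unfolding exp sum_subtractf[symmetric] Im_sum
        by (intro sum.cong refl) (simp add: vi algebra_simps)
      \<comment> \<open>Swapping the indices and using the symmetry of \<open>G\<close> identifies
        the two mixed sums, so the imaginary part cancels.\<close>
      also have "(\<Sum>i<n. \<Sum>j<n. G $$ (i, j) * a $ j * b $ i)
          = (\<Sum>i<n. \<Sum>j<n. G $$ (i, j) * b $ j * a $ i)"
        by (subst sum.swap) (intro sum.cong refl, simp add: sym mult_ac)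
      finally show ?thesis by simp
    qed
    ultimately show ?thesis by (simp add: less_complex_def)
  qed
  then show ?thesis using G adj unfolding pos_def_def by (auto simp: square_mat.simps)
qed

section \<open>Pure tensors and the Kronecker product\<close>

definition kron_vec :: "'a :: times vec \<Rightarrow> 'a vec \<Rightarrow> 'a vec" where
  "kron_vec a b = vec (dim_vec a * dim_vec b) (\<lambda>i. a $ (i div dim_vec b) * b $ (i mod dim_vec b))"

text \<open>The indices with quotient \<open>i\<close> form a block of \<open>n\<close> consecutive
  numbers, on which the remainder runs through all values below \<open>n\<close>.\<close>

lemma sum_div_mod:
  fixes f :: "nat \<Rightarrow> nat \<Rightarrow> 'a :: comm_monoid_add"
  shows "(\<Sum>k<m * n. f (k div n) (k mod n)) = (\<Sum>i<m. \<Sum>j<n. f i j)"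
proof -
  have "(\<Sum>k<m * n. f (k div n) (k mod n)) = (\<Sum>i<m. \<Sum>k = i * n..<i * n + n. f (k div n) (k mod n))"
    by (rule sum.nat_group[symmetric])
  also have "\<dots> = (\<Sum>i<m. \<Sum>j<n. f i j)"
  proof (rule sum.cong[OF refl])
    fix i
    \<comment> \<open>The bounds are written as sums with \<open>i * n\<close> on the right to match
      the index-shift rule.\<close>
    have "(\<Sum>k = 0 + i * n..<n + i * n. f (k div n) (k mod n)) = (\<Sum>j<n. f i j)"
      unfolding sum.shift_bounds_nat_ivl
      by (rule sum.cong) (auto simp: atLeast0LessThan)
    then show "(\<Sum>k = i * n..<i * n + n. f (k div n) (k mod n)) = (\<Sum>j<n. f i j)"
      by (simp add: add.commute)
  qed
  finally show ?thesis .
qed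

text \<open>The hypothesis forces \<open>b > 0\<close>, so the default values of division by zero
  never occur.\<close>

lemma div_mod_less:
  assumes "i < a * (b :: nat)"
  shows "i div b < a" "i mod b < b"
  using assms by (auto simp: less_mult_imp_div_less intro!: mod_less_divisor gr0I)

lemma kron_vec_carrier [simp]:
  "a \<in> carrier_vec m \<Longrightarrow> b \<in> carrier_vec n \<Longrightarrow> kron_vec a b \<in> carrier_vec (m * n)"
  unfolding kron_vec_def by auto

lemma kronecker_carrier [simp]:
  "A \<in> carrier_mat m m' \<Longrightarrow> B \<in> carrier_mat n n' \<Longrightarrow> kronecker A B \<in> carrier_mat (m * n) (m' * n')"
  unfolding kronecker_def by auto

text \<open>The mixed-product rule: splitting the flat column index turns each row sum into a double
  sum that factors.\<close>

lemma kronecker_mult_kron_vec: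
  fixes A B :: "'a :: comm_semiring_0 mat"
  assumes "A \<in> carrier_mat m m'" "B \<in> carrier_mat n n'" "a \<in> carrier_vec m'" "b \<in> carrier_vec n'"
  shows "kronecker A B *\<^sub>v kron_vec a b = kron_vec (A *\<^sub>v a) (B *\<^sub>v b)"
proof (rule eq_vecI)
  show "dim_vec (kronecker A B *\<^sub>v kron_vec a b) = dim_vec (kron_vec (A *\<^sub>v a) (B *\<^sub>v b))"
    by (simp add: kronecker_def kron_vec_def)
  fix i assume "i < dim_vec (kron_vec (A *\<^sub>v a) (B *\<^sub>v b))"
  then have i: "i < m * n" using assms by (simp add: kron_vec_def)
  note i' = div_mod_less[OF i]
  have "(kronecker A B *\<^sub>v kron_vec a b) $ i
      = (\<Sum>k<m' * n'. (A $$ (i div n, k div n') * B $$ (i mod n, k mod n')) * (a $ (k div n') * b $ (k mod n')))"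
    using assms i by (simp add: scalar_prod_def kronecker_def kron_vec_def atLeast0LessThan)
  also have "\<dots> = (\<Sum>j<m'. \<Sum>k<n'. (A $$ (i div n, j) * B $$ (i mod n, k)) * (a $ j * b $ k))"
    by (rule sum_div_mod)
  also have "\<dots> = (A *\<^sub>v a) $ (i div n) * (B *\<^sub>v b) $ (i mod n)"
    using assms i' by (simp add: scalar_prod_def sum_product atLeast0LessThan mult_ac)
  finally show "(kronecker A B *\<^sub>v kron_vec a b) $ i = kron_vec (A *\<^sub>v a) (B *\<^sub>v b) $ i"
    using assms i by (simp add: kron_vec_def)
qed

text \<open>The product is bilinear, without conjugation; Hermitian forms at pure tensors are
  reached by conjugating both factors of the second argument.\<close>

lemma kron_vec_scalar_prod:
  fixes a b c d :: "'a :: comm_semiring_0 vec"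
  assumes "a \<in> carrier_vec m" "b \<in> carrier_vec n" "c \<in> carrier_vec m" "d \<in> carrier_vec n"
  shows "kron_vec a b \<bullet> kron_vec c d = (a \<bullet> c) * (b \<bullet> d)"
proof -
  have "kron_vec a b \<bullet> kron_vec c d
      = (\<Sum>k<m * n. (a $ (k div n) * b $ (k mod n)) * (c $ (k div n) * d $ (k mod n)))"
    using assms by (simp add: scalar_prod_def kron_vec_def atLeast0LessThan)
  also have "\<dots> = (\<Sum>i<m. \<Sum>j<n. (a $ i * b $ j) * (c $ i * d $ j))"
    by (rule sum_div_mod)
  also have "\<dots> = (a \<bullet> c) * (b \<bullet> d)"
    using assms by (simp add: scalar_prod_def sum_product atLeast0LessThan mult_ac)
  finally show ?thesis .
qed

lemma conjugate_kron_vec: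
  fixes a b :: "complex vec"
  shows "conjugate (kron_vec a b) = kron_vec (conjugate a) (conjugate b)"
  by (rule eq_vecI) (auto simp: kron_vec_def div_mod_less)

lemma complex_mat_kronecker:
  "complex_mat (kronecker A B) = kronecker (complex_mat A) (complex_mat B)"
  by (rule eq_matI) (auto simp: kronecker_def div_mod_less)

lemma kron_vec_nonzero:
  fixes a b :: "'a :: semiring_no_zero_divisors vec"
  assumes "a \<in> carrier_vec m" "b \<in> carrier_vec n" "a \<noteq> 0\<^sub>v m" "b \<noteq> 0\<^sub>v n"
  shows "kron_vec a b \<noteq> 0\<^sub>v (m * n)"
proof -
  obtain i where i: "i < m" "a $ i \<noteq> 0" using assms(1,3) by (auto simp: vec_eq_iff)
  obtain j where j: "j < n" "b $ j \<noteq> 0" using assms(2,4) by (auto simp: vec_eq_iff)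
  \<comment> \<open>The flat index that encodes the pair \<open>(i, j)\<close>; the entry there is
    the product of two nonzero entries.\<close>
  have "i * n + j < m * n"
  proof -
    have "i * n + j < (i + 1) * n" using j by simp
    also have "\<dots> \<le> m * n" using i by (intro mult_right_mono) auto
    finally show ?thesis .
  qed
  moreover from this have "kron_vec a b $ (i * n + j) \<noteq> 0"
    using assms i j by (simp add: kron_vec_def)
  ultimately show ?thesis by (metis index_zero_vec(1))
qed

section \<open>Eigenvalue location from the Kronecker inequality\<close>

text \<open>The inequality is tested only at \<open>kron_vec w v\<close> with a fixed eigenvector
  \<open>v\<close> and arbitrary \<open>w\<close>. There its form is a positive multiple of the form
  of \<open>Q\<close> at \<open>w\<close>, so negative definiteness descends to the smaller
  matrix.\<close>

lemma lmi_region_eigenvalue: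
  fixes F G P N M :: "real mat"
  assumes F: "F \<in> carrier_mat l l" and P: "P \<in> carrier_mat l l" "pos_def P"
    and N: "N \<in> carrier_mat s s" "N\<^sup>T = N" and M: "M \<in> carrier_mat s s"
    and G: "G = P * F"
    and lmi: "neg_def (kronecker N P + kronecker M G + kronecker (M\<^sup>T) (G\<^sup>T))"
    and ev: "eigenvalue (complex_mat F) z"
  shows "z \<in> lmi_region N M"
proof -
  obtain v where v: "v \<in> carrier_vec l" "v \<noteq> 0\<^sub>v l" "complex_mat F *\<^sub>v v = z \<cdot>\<^sub>v v"
    using ev F unfolding eigenvalue_def eigenvector_def by auto
  have Gc: "G \<in> carrier_mat l l" using F P G by auto
  define c where "c = (complex_mat P *\<^sub>v v) \<bullet>c v"
  have cpos: "c > 0"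
    using pos_def_complex_mat[OF P(2)] v P unfolding pos_def_def c_def by auto
  have Pv: "complex_mat P *\<^sub>v v \<in> carrier_vec l" using P v by auto
  have Gv: "complex_mat G *\<^sub>v v = z \<cdot>\<^sub>v (complex_mat P *\<^sub>v v)"
  proof -
    have "complex_mat G = complex_mat P * complex_mat F"
      unfolding G by (rule of_real_hom.mat_hom_mult[OF P(1) F])
    then show ?thesis using P F v by (simp add: mult_mat_vec[of _ l l])
  qed
  have Gvc: "(complex_mat G *\<^sub>v v) \<bullet>c v = z * c"
    unfolding Gv c_def using P v by simp
  \<comment> \<open>\<open>G\<close> has real entries, so conjugation acts on \<open>v\<close>
    alone.\<close>
  have conjG: "conjugate (complex_mat G *\<^sub>v v) = complex_mat G *\<^sub>v conjugate v"
    using Gc v by (intro eq_vecI) (auto simp: scalar_prod_def)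
  \<comment> \<open>The transpose is the adjoint of the real matrix \<open>G\<close>, so its form at
    \<open>v\<close> is the conjugate of \<open>z * c\<close>; the factor \<open>c\<close> is real
    because it is positive.\<close>
  have Gtv: "(complex_mat (G\<^sup>T) *\<^sub>v v) \<bullet>c v = cnj z * c"
  proof -
    have "(complex_mat (G\<^sup>T) *\<^sub>v v) \<bullet>c v = v \<bullet> (complex_mat G *\<^sub>v conjugate v)"
      using transpose_vec_mult_scalar[of "complex_mat G" l l "conjugate v" v] Gc v
      by (simp add: map_mat_transpose)
    also have "\<dots> = conjugate ((complex_mat G *\<^sub>v v) \<bullet>c v)"
      unfolding conjG[symmetric] using Gc v
      by (simp add: scalar_prod_def mult_ac)
    also have "\<dots> = cnj z * c"
      using cpos unfolding Gvc by (simp add: less_complex_def complex_eq_iff)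
    finally show ?thesis .
  qed
  define Q where "Q = complex_mat N + z \<cdot>\<^sub>m complex_mat M + cnj z \<cdot>\<^sub>m (complex_mat M)\<^sup>T"
  have Qc: "Q \<in> carrier_mat s s" using N M by (auto simp: Q_def)
  have Nsym: "N $$ (i, j) = N $$ (j, i)" if "i < s" "j < s" for i j
    using that N by (metis carrier_matD index_transpose_mat(1))
  \<comment> \<open>\<open>Q\<close> is Hermitian for every \<open>z\<close>: the adjoint exchanges
    its last two summands, and \<open>N\<close> is symmetric.\<close>
  have adj: "mat_adjoint (- Q) = - Q"
    using N M by (intro eq_matI) (auto simp: mat_adjoint_index Nsym Q_def)
  have "0 < (- Q *\<^sub>v w) \<bullet>c w" if w: "w \<in> carrier_vec s" "w \<noteq> 0\<^sub>v s" for w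
  proof -
    define H where "H = kronecker N P + kronecker M G + kronecker (M\<^sup>T) (G\<^sup>T)"
    let ?x = "kron_vec w v"
    let ?Nw = "complex_mat N *\<^sub>v w" and ?Mw = "complex_mat M *\<^sub>v w"
      and ?Mtw = "complex_mat (M\<^sup>T) *\<^sub>v w"
    let ?Pv = "complex_mat P *\<^sub>v v" and ?Gv = "complex_mat G *\<^sub>v v"
      and ?Gtv = "complex_mat (G\<^sup>T) *\<^sub>v v"
    have Hc: "H \<in> carrier_mat (s * l) (s * l)" using N M P Gc by (auto simp: H_def)
    have x: "?x \<in> carrier_vec (s * l)" "?x \<noteq> 0\<^sub>v (s * l)"
      using w v kron_vec_nonzero[of w s v l] by auto
    have Nw: "?Nw \<in> carrier_vec s" "?Mw \<in> carrier_vec s" "?Mtw \<in> carrier_vec s"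
      using N M w by auto
    have Gvs: "?Gv \<in> carrier_vec l" "?Gtv \<in> carrier_vec l" using Gc v by auto
    have cw: "conjugate w \<in> carrier_vec s" "conjugate v \<in> carrier_vec l" using w v by auto
    have "complex_mat H = kronecker (complex_mat N) (complex_mat P)
        + kronecker (complex_mat M) (complex_mat G) + kronecker (complex_mat (M\<^sup>T)) (complex_mat (G\<^sup>T))"
      using N M P Gc unfolding complex_mat_kronecker[symmetric] H_def
      by (intro eq_matI) (auto simp: kronecker_def)
    then have Hx: "complex_mat H *\<^sub>v ?x = kron_vec ?Nw ?Pv + kron_vec ?Mw ?Gv + kron_vec ?Mtw ?Gtv"
      using N M P Gc w v
      by (simp add: add_mult_distrib_mat_vec[of _ "s * l" "s * l"]
          kronecker_mult_kron_vec[of _ s s _ l l])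
    have "complex_mat (- H) = - complex_mat H" by (intro eq_matI) auto
    then have Hx': "complex_mat (- H) *\<^sub>v ?x = - (complex_mat H *\<^sub>v ?x)"
      using Hc x by (simp add: carrier_vecD)
    have "0 < (complex_mat (- H) *\<^sub>v ?x) \<bullet>c ?x"
      using pos_def_complex_mat[OF lmi] x Hc unfolding pos_def_def H_def[symmetric] by auto
    also have "\<dots> = - ((complex_mat H *\<^sub>v ?x) \<bullet>c ?x)"
      unfolding Hx' using Hc x by (intro scalar_prod_uminus_left) (simp add: carrier_vecD)
    \<comment> \<open>Each Kronecker product contributes a product of two scalars, and the factor
      belonging to \<open>v\<close> is \<open>c\<close>, \<open>z * c\<close> or
      \<open>cnj z * c\<close>. Hence \<open>c\<close> can be pulled out of the whole form.\<close>
    also have "(complex_mat H *\<^sub>v ?x) \<bullet>c ?x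
      = (?Nw \<bullet>c w) * c + (?Mw \<bullet>c w) * (z * c) + (?Mtw \<bullet>c w) * (cnj z * c)"
    proof -
      have k: "kron_vec ?Nw ?Pv \<in> carrier_vec (s * l)" "kron_vec ?Mw ?Gv \<in> carrier_vec (s * l)"
        "kron_vec ?Mtw ?Gtv \<in> carrier_vec (s * l)"
        "kron_vec (conjugate w) (conjugate v) \<in> carrier_vec (s * l)"
        using Nw Pv Gvs cw by (blast intro: kron_vec_carrier)+
      show ?thesis
        unfolding Hx conjugate_kron_vec
          add_scalar_prod_distrib[OF add_carrier_vec[OF k(1,2)] k(3,4)]
          add_scalar_prod_distrib[OF k(1,2,4)]
          kron_vec_scalar_prod[OF Nw(1) Pv cw]
          kron_vec_scalar_prod[OF Nw(2) Gvs(1) cw]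
          kron_vec_scalar_prod[OF Nw(3) Gvs(2) cw] Gvc Gtv
        by (simp add: c_def)
    qed
    also have "- \<dots> = c * ((- Q *\<^sub>v w) \<bullet>c w)"
    proof -
      have "Q *\<^sub>v w = (complex_mat N + z \<cdot>\<^sub>m complex_mat M) *\<^sub>v w
          + (cnj z \<cdot>\<^sub>m complex_mat (M\<^sup>T)) *\<^sub>v w"
        unfolding Q_def map_mat_transpose using N M w
        by (intro add_mult_distrib_mat_vec[of _ s s]) auto
      also have "(complex_mat N + z \<cdot>\<^sub>m complex_mat M) *\<^sub>v w = ?Nw + (z \<cdot>\<^sub>m complex_mat M) *\<^sub>v w"
        using N M w by (intro add_mult_distrib_mat_vec[of _ s s]) auto
      also have "(z \<cdot>\<^sub>m complex_mat M) *\<^sub>v w = z \<cdot>\<^sub>v ?Mw"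
        using M w by (intro smult_mat_mult_vec) auto
      also have "(cnj z \<cdot>\<^sub>m complex_mat (M\<^sup>T)) *\<^sub>v w = cnj z \<cdot>\<^sub>v ?Mtw"
        using M w by (intro smult_mat_mult_vec) auto
      finally have "(Q *\<^sub>v w) \<bullet>c w = (?Nw \<bullet>c w) + z * (?Mw \<bullet>c w) + cnj z * (?Mtw \<bullet>c w)"
        using Nw cw by (simp add: add_scalar_prod_distrib[of _ s])
      moreover have "(- Q *\<^sub>v w) \<bullet>c w = - ((Q *\<^sub>v w) \<bullet>c w)"
        using Qc w by simp
      ultimately show ?thesis by (simp add: right_diff_distrib mult_ac)
    qed
    finally have "0 < c * ((- Q *\<^sub>v w) \<bullet>c w)" .
    then show ?thesis using cpos by (rule complex_mult_pos_cancel)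
  qed
  then have "neg_def Q"
    using Qc adj unfolding pos_def_def by (auto simp: square_mat.simps)
  then show ?thesis unfolding lmi_region_def mem_Collect_eq Q_def .
qed

subsection \<open>Quadratic Lyapunov functions\<close>

text \<open>The integrating factor \<open>exp (k * (t - t0))\<close>, applied to the distance of
  \<open>V\<close> from the equilibrium \<open>b / k\<close> of \<open>V' + k V = b\<close>, gives a
  nonincreasing function.\<close>

lemma gronwall_exponential_decay:
  fixes V V' :: "real \<Rightarrow> real"
  assumes der: "\<And>t. t \<ge> t0 \<Longrightarrow> (V has_real_derivative V' t) (at t within {t0..})"
    and ineq: "\<And>t. t \<ge> t0 \<Longrightarrow> V' t + k * V t \<le> b"
    and "k > 0" "b \<ge> 0" "t \<ge> t0"
  shows "V t \<le> b / k + V t0 * exp (- k * (t - t0))"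
proof -
  define g where "g s = (V s - b / k) * exp (k * (s - t0))" for s
  have g_der: "(g has_real_derivative (V' s + k * V s - b) * exp (k * (s - t0))) (at s within {t0..})"
    if "s \<ge> t0" for s
    unfolding g_def using \<open>k > 0\<close>
    by (auto intro!: derivative_eq_intros der[OF that] simp: field_simps)
  have "g t \<le> g t0"
  proof (rule DERIV_nonpos_imp_decreasing_open[OF \<open>t \<ge> t0\<close>])
    fix s assume s: "t0 < s" "s < t"
    \<comment> \<open>The derivative at \<open>t0\<close> is only one-sided, so the monotonicity
      argument uses derivatives at interior points and mere continuity at the ends.\<close>
    have "at s within {t0..} = at s" using s by (intro at_within_interior) simp
    moreover have "(V' s + k * V s - b) * exp (k * (s - t0)) \<le> 0"
      using ineq[of s] s by (intro mult_nonpos_nonneg) auto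
    ultimately show "\<exists>y. (g has_real_derivative y) (at s) \<and> y \<le> 0"
      using g_der[of s] s by auto
  next
    have "continuous_on {t0..} g"
      using g_der by (intro DERIV_continuous_on) auto
    then show "continuous_on {t0..t} g" by (rule continuous_on_subset) auto
  qed
  then have "V t - b / k \<le> (V t0 - b / k) * exp (- k * (t - t0))"
    by (simp add: g_def exp_minus pos_le_divide_eq[symmetric] divide_inverse)
  \<comment> \<open>The offset \<open>b / k\<close> is nonnegative and may be dropped from the
    initial value.\<close>
  also have "\<dots> \<le> V t0 * exp (- k * (t - t0))"
    using \<open>k > 0\<close> \<open>b \<ge> 0\<close> by (intro mult_right_mono) auto
  finally show ?thesis by simp
qed

text \<open>The product rule yields two bilinear terms, which coincide because \<open>P\<close> is
  symmetric.\<close>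

lemma quadratic_form_has_derivative:
  fixes P :: "real mat"
  assumes P: "P \<in> carrier_mat l l" "P\<^sup>T = P"
    and e: "\<And>s. s \<in> S \<Longrightarrow> e s \<in> carrier_vec l" and "t \<in> S"
    and d: "d \<in> carrier_vec l" "has_vec_derivative e d (at t within S)"
  shows "((\<lambda>s. (P *\<^sub>v e s) \<bullet> e s) has_real_derivative 2 * ((P *\<^sub>v e t) \<bullet> d)) (at t within S)"
proof -
  let ?f = "\<lambda>s. \<Sum>i<l. \<Sum>j<l. P $$ (i, j) * e s $ j * e s $ i"
  have et: "e t \<in> carrier_vec l" using e \<open>t \<in> S\<close> .
  have comp: "((\<lambda>s. e s $ i) has_real_derivative d $ i) (at t within S)" if "i < l" for i
    using d that unfolding has_vec_derivative_def by auto
  have "(?f has_real_derivative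
      (\<Sum>i<l. \<Sum>j<l. P $$ (i, j) * d $ j * e t $ i + P $$ (i, j) * e t $ j * d $ i)) (at t within S)"
    by (intro DERIV_sum) (auto intro!: derivative_eq_intros comp)
  also have "(\<Sum>i<l. \<Sum>j<l. P $$ (i, j) * d $ j * e t $ i + P $$ (i, j) * e t $ j * d $ i)
      = (P *\<^sub>v d) \<bullet> e t + (P *\<^sub>v e t) \<bullet> d"
    unfolding mult_mat_vec_scalar_prod_sum[OF P(1) d(1) et]
      mult_mat_vec_scalar_prod_sum[OF P(1) et d(1)] sum.distrib ..
  also have "(P *\<^sub>v d) \<bullet> e t = (P *\<^sub>v e t) \<bullet> d"
    using transpose_vec_mult_scalar[OF P(1) et d(1)] P d et
    by (simp add: comm_scalar_prod[of d l])
  finally have f: "(?f has_real_derivative 2 * ((P *\<^sub>v e t) \<bullet> d)) (at t within S)" by simp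
  \<comment> \<open>Outside \<open>S\<close> the dimension of \<open>e s\<close> is unconstrained,
    so the double sum is known to agree with the form only on \<open>S\<close>; the radius
    \<open>1\<close> is arbitrary.\<close>
  show ?thesis
  proof (rule has_field_derivative_transform_within[OF f, where d = 1])
    show "?f s = (P *\<^sub>v e s) \<bullet> e s" if "s \<in> S" for s
      by (rule mult_mat_vec_scalar_prod_sum[OF P(1) e e, symmetric]) (fact that)+
  qed (use \<open>t \<in> S\<close> in auto)
qed

text \<open>A nonzero kernel vector would make the form vanish, so \<open>P\<close> is invertible,
  \<open>mat_inverse\<close> returns \<open>Some\<close>, and \<open>the\<close> is
  meaningful.\<close>

lemma pos_def_mult_mat_inverse:
  fixes P :: "real mat"
  assumes P: "P \<in> carrier_mat l l" "pos_def P"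
  shows "P * the (mat_inverse P) = 1\<^sub>m l" "the (mat_inverse P) \<in> carrier_mat l l"
proof -
  have "det P \<noteq> 0"
  proof
    assume "det P = 0"
    then obtain v where v: "v \<in> carrier_vec l" "v \<noteq> 0\<^sub>v l" "P *\<^sub>v v = 0\<^sub>v l"
      using det_0_iff_vec_prod_zero_field[OF P(1)] by auto
    then have "0 < (P *\<^sub>v v) \<bullet>c v" using P unfolding pos_def_def by auto
    then show False using v by simp
  qed
  then have "P \<in> Units (ring_mat TYPE(real) l ())" by (rule det_non_zero_imp_unit[OF P(1)])
  then obtain B where "mat_inverse P = Some B"
    using mat_inverse(1)[OF P(1), where b = "()"] by (cases "mat_inverse P") auto
  then show "P * the (mat_inverse P) = 1\<^sub>m l" "the (mat_inverse P) \<in> carrier_mat l l"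
    using mat_inverse(2)[OF P(1)] by auto
qed

text \<open>The first summand on the left is the derivative of the form of \<open>P\<close> when
  \<open>a\<close> moves along the closed loop driven by \<open>b\<close>. The left side minus
  \<open>b \<bullet> b\<close> is the form of the block matrix at the stacked vector of
  \<open>a\<close> and \<open>b\<close>.\<close>

lemma lmi_dissipation:
  fixes A B C L P Y :: "real mat" and a b :: "real vec"
  assumes A: "A \<in> carrier_mat l l" and B: "B \<in> carrier_mat l q" and C: "C \<in> carrier_mat p l"
    and L: "L \<in> carrier_mat l p" and P: "P \<in> carrier_mat l l" "P\<^sup>T = P" and Y: "Y = P * L"
    and a: "a \<in> carrier_vec l" and b: "b \<in> carrier_vec q"
    and lmi: "neg_semidef (four_block_mat
           (P * A + A\<^sup>T * P - Y * C - C\<^sup>T * Y\<^sup>T + k \<cdot>\<^sub>m P) (P * B) (B\<^sup>T * P) (- 1\<^sub>m q))"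
  shows "2 * ((P *\<^sub>v a) \<bullet> ((A - L * C) *\<^sub>v a + B *\<^sub>v b)) + k * ((P *\<^sub>v a) \<bullet> a) \<le> b \<bullet> b"
proof -
  define X where "X = P * A + A\<^sup>T * P - Y * C - C\<^sup>T * Y\<^sup>T + k \<cdot>\<^sub>m P"
  define S where "S = four_block_mat X (P * B) (B\<^sup>T * P) (- 1\<^sub>m q)"
  have Yc: "Y \<in> carrier_mat l p" using P L Y by auto
  have parts: "P * A \<in> carrier_mat l l" "A\<^sup>T * P \<in> carrier_mat l l" "Y * C \<in> carrier_mat l l"
      "C\<^sup>T * Y\<^sup>T \<in> carrier_mat l l" "k \<cdot>\<^sub>m P \<in> carrier_mat l l"
    using A P Yc C by auto
  have Xc: "X \<in> carrier_mat l l" using parts unfolding X_def by auto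
  have Sc: "S \<in> carrier_mat (l + q) (l + q)" using Xc unfolding S_def by auto
  have Pa: "P *\<^sub>v a \<in> carrier_vec l" and Aa: "A *\<^sub>v a \<in> carrier_vec l"
    and Ca: "C *\<^sub>v a \<in> carrier_vec p" and Bb: "B *\<^sub>v b \<in> carrier_vec l"
    using P A B C a b by auto
  have LCa: "L *\<^sub>v (C *\<^sub>v a) \<in> carrier_vec l" using L Ca by auto
  have swap: "(P *\<^sub>v c) \<bullet> a = (P *\<^sub>v a) \<bullet> c" if "c \<in> carrier_vec l" for c
    using transpose_vec_mult_scalar[OF P(1) a that] P a that by (simp add: comm_scalar_prod[of c l])
  have "((P * A) *\<^sub>v a) \<bullet> a = (P *\<^sub>v a) \<bullet> (A *\<^sub>v a)"
    using P A a swap[OF Aa] by simp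
  moreover have "((A\<^sup>T * P) *\<^sub>v a) \<bullet> a = (P *\<^sub>v a) \<bullet> (A *\<^sub>v a)"
    using P A a transpose_vec_mult_scalar[OF A a Pa] by simp
  moreover have "((Y * C) *\<^sub>v a) \<bullet> a = (P *\<^sub>v a) \<bullet> (L *\<^sub>v (C *\<^sub>v a))"
  proof -
    have "(Y * C) *\<^sub>v a = Y *\<^sub>v (C *\<^sub>v a)" by (rule assoc_mult_mat_vec[OF Yc C a])
    also have "\<dots> = P *\<^sub>v (L *\<^sub>v (C *\<^sub>v a))" unfolding Y by (rule assoc_mult_mat_vec[OF P(1) L Ca])
    finally show ?thesis by (simp only: swap[OF LCa])
  qed
  \<comment> \<open>A matrix and its transpose have the same real quadratic form, so the
    output-injection term is counted twice.\<close>
  moreover have "((C\<^sup>T * Y\<^sup>T) *\<^sub>v a) \<bullet> a = ((Y * C) *\<^sub>v a) \<bullet> a"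
  proof -
    have "((Y * C)\<^sup>T *\<^sub>v a) \<bullet> a = a \<bullet> ((Y * C) *\<^sub>v a)"
      by (rule transpose_vec_mult_scalar[OF parts(3) a a])
    also have "\<dots> = ((Y * C) *\<^sub>v a) \<bullet> a"
      by (rule comm_scalar_prod[OF a mult_mat_vec_carrier[OF parts(3) a]])
    finally show ?thesis unfolding transpose_mult[OF Yc C] .
  qed
  moreover have "((k \<cdot>\<^sub>m P) *\<^sub>v a) \<bullet> a = k * ((P *\<^sub>v a) \<bullet> a)"
    using P a by (simp add: smult_mat_mult_vec)
  moreover have "(X *\<^sub>v a) \<bullet> a = ((P * A) *\<^sub>v a) \<bullet> a + ((A\<^sup>T * P) *\<^sub>v a) \<bullet> a
      - ((Y * C) *\<^sub>v a) \<bullet> a - ((C\<^sup>T * Y\<^sup>T) *\<^sub>v a) \<bullet> a + ((k \<cdot>\<^sub>m P) *\<^sub>v a) \<bullet> a"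
  proof -
    have add: "((U + W) *\<^sub>v a) \<bullet> a = (U *\<^sub>v a) \<bullet> a + (W *\<^sub>v a) \<bullet> a"
      if U: "U \<in> carrier_mat l l" and W: "W \<in> carrier_mat l l" for U W
      unfolding add_mult_distrib_mat_vec[OF U W a]
      by (rule add_scalar_prod_distrib[OF mult_mat_vec_carrier[OF U a] mult_mat_vec_carrier[OF W a] a])
    have sub: "((U - W) *\<^sub>v a) \<bullet> a = (U *\<^sub>v a) \<bullet> a - (W *\<^sub>v a) \<bullet> a"
      if U: "U \<in> carrier_mat l l" and W: "W \<in> carrier_mat l l" for U W
      unfolding minus_mult_distrib_mat_vec[OF U W a]
      by (rule minus_scalar_prod_distrib[OF mult_mat_vec_carrier[OF U a] mult_mat_vec_carrier[OF W a] a])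
    have s: "P * A + A\<^sup>T * P \<in> carrier_mat l l" "P * A + A\<^sup>T * P - Y * C \<in> carrier_mat l l"
      "P * A + A\<^sup>T * P - Y * C - C\<^sup>T * Y\<^sup>T \<in> carrier_mat l l"
      using parts by (auto intro!: minus_carrier_mat add_carrier_mat)
    show ?thesis
      unfolding X_def add[OF s(3) parts(5)] sub[OF s(2) parts(4)] sub[OF s(1) parts(3)]
        add[OF parts(1,2)] ..
  qed
  ultimately have Xa: "(X *\<^sub>v a) \<bullet> a
      = 2 * ((P *\<^sub>v a) \<bullet> (A *\<^sub>v a)) - 2 * ((P *\<^sub>v a) \<bullet> (L *\<^sub>v (C *\<^sub>v a))) + k * ((P *\<^sub>v a) \<bullet> a)"
    by linarith
  have ab: "a @\<^sub>v b \<in> carrier_vec (l + q)" using a b by auto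
  \<comment> \<open>The block form splits into the form of \<open>X\<close>, two equal cross terms
    from the off-diagonal blocks, and \<open>- (b \<bullet> b)\<close> from the last block.\<close>
  have "0 \<ge> (S *\<^sub>v (a @\<^sub>v b)) \<bullet> (a @\<^sub>v b)"
    using lmi ab Sc unfolding pos_semidef_def X_def[symmetric] S_def[symmetric] by auto
  also have "S *\<^sub>v (a @\<^sub>v b)
      = (X *\<^sub>v a + (P * B) *\<^sub>v b) @\<^sub>v ((B\<^sup>T * P) *\<^sub>v a + (- 1\<^sub>m q) *\<^sub>v b)"
    unfolding S_def using Xc P B a b by (intro four_block_mat_mult_vec[of _ l l _ q _ q]) auto
  also have "\<dots> \<bullet> (a @\<^sub>v b)
      = (X *\<^sub>v a + (P * B) *\<^sub>v b) \<bullet> a + ((B\<^sup>T * P) *\<^sub>v a + (- 1\<^sub>m q) *\<^sub>v b) \<bullet> b"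
    using Xc P B a b by (intro scalar_prod_append) auto
  also have "(X *\<^sub>v a + (P * B) *\<^sub>v b) \<bullet> a = (X *\<^sub>v a) \<bullet> a + (P *\<^sub>v a) \<bullet> (B *\<^sub>v b)"
  proof -
    have "(X *\<^sub>v a + (P * B) *\<^sub>v b) \<bullet> a = (X *\<^sub>v a) \<bullet> a + ((P * B) *\<^sub>v b) \<bullet> a"
      using Xc P B a b by (intro add_scalar_prod_distrib) auto
    then show ?thesis using swap[OF Bb] P B b by simp
  qed
  also have "((B\<^sup>T * P) *\<^sub>v a + (- 1\<^sub>m q) *\<^sub>v b) \<bullet> b = (P *\<^sub>v a) \<bullet> (B *\<^sub>v b) - b \<bullet> b"
  proof -
    have "((B\<^sup>T * P) *\<^sub>v a + (- 1\<^sub>m q) *\<^sub>v b) \<bullet> b = ((B\<^sup>T * P) *\<^sub>v a) \<bullet> b + ((- 1\<^sub>m q) *\<^sub>v b) \<bullet> b"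
      using P B a b by (intro add_scalar_prod_distrib) auto
    moreover have "(- 1\<^sub>m q) *\<^sub>v b = - b" using b by simp
    moreover have "((B\<^sup>T * P) *\<^sub>v a) \<bullet> b = (P *\<^sub>v a) \<bullet> (B *\<^sub>v b)"
      using transpose_vec_mult_scalar[OF B b Pa] P B a by simp
    ultimately show ?thesis using b by simp
  qed
  finally have main: "(X *\<^sub>v a) \<bullet> a + 2 * ((P *\<^sub>v a) \<bullet> (B *\<^sub>v b)) \<le> b \<bullet> b" by simp
  have "(A - L * C) *\<^sub>v a = A *\<^sub>v a - L *\<^sub>v (C *\<^sub>v a)"
    using A L C a by (simp add: minus_mult_distrib_mat_vec[of _ l l])
  moreover have "(P *\<^sub>v a) \<bullet> (A *\<^sub>v a - L *\<^sub>v (C *\<^sub>v a) + B *\<^sub>v b)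
      = (P *\<^sub>v a) \<bullet> (A *\<^sub>v a) - (P *\<^sub>v a) \<bullet> (L *\<^sub>v (C *\<^sub>v a)) + (P *\<^sub>v a) \<bullet> (B *\<^sub>v b)"
    using scalar_prod_add_distrib[OF Pa minus_carrier_vec[OF Aa LCa] Bb]
      scalar_prod_minus_distrib[OF Pa Aa LCa] by simp
  ultimately show ?thesis using main Xa by simp
qed

section \<open>Dimensions of the augmented system and the output bound\<close>

lemma aug_carriers:
  assumes "A \<in> carrier_mat n n" "Bw \<in> carrier_mat n q" "Cx \<in> carrier_mat p n" "Dw \<in> carrier_mat p q"
    and "l = n + (r + 1) * q"
  shows "aug_A n q r A Bw \<in> carrier_mat l l" "aug_B n q r \<in> carrier_mat l q"
    "aug_C p q r Cx Dw \<in> carrier_mat p l" "K_mat n q r A Bw T \<in> carrier_mat n l"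
  using assms
  by (auto simp: aug_A_def aug_B_def aug_C_def K_mat_def append_cols_def aug_Psi_def aug_Pi_def
      Phi_def mat_exp_def mat_suminf_def Gamma_row_def algebra_simps)

text \<open>The form of \<open>K\<^sup>T * K\<close> at \<open>a\<close> is the squared norm of
  \<open>K a\<close>, so the semidefinite inequality turns a bound on the Lyapunov function into one
  on the output.\<close>

lemma euclid_norm_le:
  fixes K P :: "real mat"
  assumes K: "K \<in> carrier_mat n l" and P: "P \<in> carrier_mat l l" and a: "a \<in> carrier_vec l"
    and "\<alpha> > 0" and psd: "pos_semidef (P - \<alpha> \<cdot>\<^sub>m (K\<^sup>T * K))"
  shows "euclid_norm (K *\<^sub>v a) \<le> sqrt (((P *\<^sub>v a) \<bullet> a) / \<alpha>)"
proof -
  have Ka: "K *\<^sub>v a \<in> carrier_vec n" and KK: "K\<^sup>T * K \<in> carrier_mat l l" using K a by auto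
  have KKa: "((K\<^sup>T * K) *\<^sub>v a) \<bullet> a = (K *\<^sub>v a) \<bullet> (K *\<^sub>v a)"
    using K a transpose_vec_mult_scalar[OF K a Ka] by simp
  have "0 \<le> ((P - \<alpha> \<cdot>\<^sub>m (K\<^sup>T * K)) *\<^sub>v a) \<bullet> a"
    using psd a K unfolding pos_semidef_def by auto
  also have "(P - \<alpha> \<cdot>\<^sub>m (K\<^sup>T * K)) *\<^sub>v a = P *\<^sub>v a - \<alpha> \<cdot>\<^sub>v ((K\<^sup>T * K) *\<^sub>v a)"
    using P KK a minus_mult_distrib_mat_vec[of P l l "\<alpha> \<cdot>\<^sub>m (K\<^sup>T * K)" a]
      smult_mat_mult_vec[of a "K\<^sup>T * K" \<alpha>] by auto
  also have "\<dots> \<bullet> a = (P *\<^sub>v a) \<bullet> a - (\<alpha> \<cdot>\<^sub>v ((K\<^sup>T * K) *\<^sub>v a)) \<bullet> a"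
    using P KK a by (intro minus_scalar_prod_distrib) auto
  also have "(\<alpha> \<cdot>\<^sub>v ((K\<^sup>T * K) *\<^sub>v a)) \<bullet> a = \<alpha> * ((K *\<^sub>v a) \<bullet> (K *\<^sub>v a))"
    unfolding KKa[symmetric] using KK a by (intro smult_scalar_prod_distrib) auto
  finally show ?thesis
    using \<open>\<alpha> > 0\<close> unfolding euclid_norm_def by (simp add: field_simps)
qed

section \<open>Exponential approach to the ball and location of the closed-loop eigenvalues\<close>

theorem lemma2:
  fixes n m p q r l s :: nat
    and h T eps t0 \<alpha> \<delta> :: real
    and A Bu Bw Cx Dw Abar Bbar Cbar K P Y L N M :: "real mat"
    and x u w y :: "real \<Rightarrow> real vec"
    and D :: "complex set"
  assumes "n \<ge> 1" "m \<ge> 1" "p \<ge> 1" "q \<ge> 1"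
    and "l = n + (r + 1) * q"
    and "h \<ge> 0" "T \<ge> 0" "eps \<ge> 0"
    and "A \<in> carrier_mat n n" "Bu \<in> carrier_mat n m" "Bw \<in> carrier_mat n q"
    and "Cx \<in> carrier_mat p n" "Dw \<in> carrier_mat p q"
    and "\<And>t. w t \<in> carrier_vec q"
    and "continuously_differentiable q (r + 1) w"
    and "\<And>t. euclid_norm (vec_deriv q (r + 1) w t) \<le> eps"
    and "\<And>t. t \<ge> t0 - h \<Longrightarrow> u t \<in> carrier_vec m"
    and "piecewise_constant_from (t0 - h) u"
    and "plant_state A Bu Bw h t0 u w x"
    and "\<And>t. t \<ge> t0 \<Longrightarrow> y t = Cx *\<^sub>v x t + Dw *\<^sub>v w t"
    and "Abar = aug_A n q r A Bw"
    and "Bbar = aug_B n q r"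
    and "Cbar = aug_C p q r Cx Dw"
    and "K = K_mat n q r A Bw T"
    and "observable Abar Cbar"
    and "N \<in> carrier_mat s s" "N\<^sup>T = N" "M \<in> carrier_mat s s"
    and "D = lmi_region N M"
    and "bounded D"
    and "\<alpha> > 0" "\<delta> > 0"
    and "P \<in> carrier_mat l l" "pos_def P"
    and "Y \<in> carrier_mat l p"
    and "neg_semidef (four_block_mat
           (P * Abar + Abar\<^sup>T * P - Y * Cbar - Cbar\<^sup>T * Y\<^sup>T + (2 * \<delta>) \<cdot>\<^sub>m P) (P * Bbar)
           (Bbar\<^sup>T * P) (- 1\<^sub>m q))"
    and "pos_semidef (P - \<alpha> \<cdot>\<^sub>m (K\<^sup>T * K))"
    and "neg_def (kronecker N P + kronecker M (P * Abar - Y * Cbar)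
           + kronecker (M\<^sup>T) ((P * Abar - Y * Cbar)\<^sup>T))"
    and "L = the (mat_inverse P) * Y"
  shows "(\<forall>e0\<in>carrier_vec l. \<exists>c\<ge>0. \<forall>e.
            ode_solution l t0
              (\<lambda>t v. (Abar - L * Cbar) *\<^sub>v v + Bbar *\<^sub>v vec_deriv q (r + 1) w t) e
            \<longrightarrow> e t0 = e0
            \<longrightarrow> (\<forall>t\<ge>t0. euclid_norm (K *\<^sub>v e t)
                   \<le> eps * sqrt (1 / (2 * \<alpha> * \<delta>)) + c * exp (- \<delta> * (t - t0))))
       \<and> (\<forall>z. eigenvalue (complex_mat (Abar - L * Cbar)) z \<longrightarrow> z \<in> D)"
proof -
  note carr = aug_carriers[OF \<open>A \<in> carrier_mat n n\<close> \<open>Bw \<in> carrier_mat n q\<close>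
      \<open>Cx \<in> carrier_mat p n\<close> \<open>Dw \<in> carrier_mat p q\<close> \<open>l = n + (r + 1) * q\<close>]
  have Ac: "Abar \<in> carrier_mat l l" and Bc: "Bbar \<in> carrier_mat l q"
    and Cc: "Cbar \<in> carrier_mat p l" and Kc: "K \<in> carrier_mat n l"
    using carr \<open>Abar = _\<close> \<open>Bbar = _\<close> \<open>Cbar = _\<close> \<open>K = _\<close> by simp_all
  note P = \<open>P \<in> carrier_mat l l\<close> and Pd = \<open>pos_def P\<close> and Yc = \<open>Y \<in> carrier_mat l p\<close>
  note inv = pos_def_mult_mat_inverse[OF P Pd]
  have Lc: "L \<in> carrier_mat l p" using \<open>L = _\<close> inv Yc by simp
  have PL: "Y = P * L"
    using assoc_mult_mat[OF P inv(2) Yc] inv(1) Yc \<open>L = _\<close> by simp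
  have Psym: "P\<^sup>T = P" using symmetric_if_hermitian_real[OF P] Pd unfolding pos_def_def by blast
  let ?F = "Abar - L * Cbar" and ?w = "vec_deriv q (r + 1) w"
  have Fc: "?F \<in> carrier_mat l l" using Lc Cc by auto
  \<comment> \<open>With \<open>Y = P L\<close>, the matrix in the Kronecker inequality is
    \<open>P\<close> times the closed loop.\<close>
  have "P * ?F = P * Abar - Y * Cbar"
    unfolding PL assoc_mult_mat[OF P Lc Cc] using P Ac Lc Cc
    by (intro mult_minus_distrib_mat) auto
  then have "z \<in> D" if "eigenvalue (complex_mat ?F) z" for z
    unfolding \<open>D = lmi_region N M\<close> using assms that
    by (intro lmi_region_eigenvalue[OF Fc P Pd]) simp_all
  moreover have "\<exists>c\<ge>0. \<forall>e. ode_solution l t0 (\<lambda>t v. ?F *\<^sub>v v + Bbar *\<^sub>v ?w t) e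
            \<longrightarrow> e t0 = e0
            \<longrightarrow> (\<forall>t\<ge>t0. euclid_norm (K *\<^sub>v e t)
                   \<le> eps * sqrt (1 / (2 * \<alpha> * \<delta>)) + c * exp (- \<delta> * (t - t0)))"
    if e0: "e0 \<in> carrier_vec l" for e0
  proof (intro exI conjI allI impI)
    have V0: "0 \<le> (P *\<^sub>v e0) \<bullet> e0"
      using Pd P e0 unfolding pos_def_def by (cases "e0 = 0\<^sub>v l") force+
    \<comment> \<open>The witness for \<open>c\<close> depends only on the initial error; it is the
      output bound evaluated at \<open>e0\<close>.\<close>
    show "0 \<le> sqrt ((P *\<^sub>v e0) \<bullet> e0 / \<alpha>)" using V0 \<open>\<alpha> > 0\<close> by simp
    fix e t
    assume sol: "ode_solution l t0 (\<lambda>t v. ?F *\<^sub>v v + Bbar *\<^sub>v ?w t) e"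
      and init: "e t0 = e0" and t: "t0 \<le> t"
    have ec: "e s \<in> carrier_vec l" if "s \<in> {t0..}" for s
      using sol that unfolding ode_solution_def by auto
    have wc: "?w s \<in> carrier_vec q" for s by (simp add: vec_deriv_def)
    let ?d = "\<lambda>s. ?F *\<^sub>v e s + Bbar *\<^sub>v ?w s"
    have der: "((\<lambda>s. (P *\<^sub>v e s) \<bullet> e s) has_real_derivative 2 * ((P *\<^sub>v e s) \<bullet> ?d s)) (at s within {t0..})"
      if s: "s \<ge> t0" for s
    proof (rule quadratic_form_has_derivative[OF P Psym ec])
      show "?d s \<in> carrier_vec l" using Fc Bc ec wc s by auto
      show "has_vec_derivative e (?d s) (at s within {t0..})"
        using sol s unfolding ode_solution_def by auto
    qed (use s in auto)
    have ineq: "2 * ((P *\<^sub>v e s) \<bullet> ?d s) + 2 * \<delta> * ((P *\<^sub>v e s) \<bullet> e s) \<le> eps\<^sup>2" if s: "s \<ge> t0" for s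
    proof -
      have "2 * ((P *\<^sub>v e s) \<bullet> ?d s) + 2 * \<delta> * ((P *\<^sub>v e s) \<bullet> e s) \<le> ?w s \<bullet> ?w s"
        by (rule lmi_dissipation[OF Ac Bc Cc Lc P Psym PL ec wc]) (use assms s in auto)
      also have "\<dots> = (euclid_norm (?w s))\<^sup>2"
        unfolding euclid_norm_def by (simp add: scalar_prod_def sum_nonneg)
      \<comment> \<open>\<open>assms(16)\<close> is the uniform bound on the derivative of order
        \<open>r + 1\<close> of the disturbance.\<close>
      also have "\<dots> \<le> eps\<^sup>2"
        using assms(16)[of s] by (intro power_mono) (auto simp: euclid_norm_def scalar_prod_def sum_nonneg)
      finally show ?thesis .
    qed
    have "euclid_norm (K *\<^sub>v e t) \<le> sqrt ((P *\<^sub>v e t) \<bullet> e t / \<alpha>)"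
      using euclid_norm_le[OF Kc P ec \<open>\<alpha> > 0\<close>] assms t by simp
    \<comment> \<open>The Lyapunov function decays at rate \<open>2 * \<delta>\<close>; the square
      root halves this to \<delta>.\<close>
    also have "\<dots> \<le> sqrt ((eps\<^sup>2 / (2 * \<delta>) + (P *\<^sub>v e0) \<bullet> e0 * exp (- (2 * \<delta>) * (t - t0))) / \<alpha>)"
      using gronwall_exponential_decay[OF der ineq _ _ t] \<open>\<delta> > 0\<close> \<open>\<alpha> > 0\<close>
      unfolding init by (intro real_sqrt_le_mono divide_right_mono) auto
    also have "\<dots> = sqrt (eps\<^sup>2 * (1 / (2 * \<alpha> * \<delta>)) + (P *\<^sub>v e0) \<bullet> e0 / \<alpha> * (exp (- \<delta> * (t - t0)))\<^sup>2)"
      using \<open>\<alpha> > 0\<close> by (simp add: add_divide_distrib exp_double[symmetric] mult_ac)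
    \<comment> \<open>Subadditivity of the square root separates the radius of the ball from the
      transient.\<close>
    also have "\<dots> \<le> sqrt (eps\<^sup>2 * (1 / (2 * \<alpha> * \<delta>))) + sqrt ((P *\<^sub>v e0) \<bullet> e0 / \<alpha> * (exp (- \<delta> * (t - t0)))\<^sup>2)"
      using V0 \<open>\<delta> > 0\<close> \<open>\<alpha> > 0\<close> by (intro sqrt_add_le_add_sqrt) auto
    also have "\<dots> = eps * sqrt (1 / (2 * \<alpha> * \<delta>)) + sqrt ((P *\<^sub>v e0) \<bullet> e0 / \<alpha>) * exp (- \<delta> * (t - t0))"
      unfolding real_sqrt_mult using \<open>eps \<ge> 0\<close> by simp
    finally show "euclid_norm (K *\<^sub>v e t) \<le> eps * sqrt (1 / (2 * \<alpha> * \<delta>))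
        + sqrt ((P *\<^sub>v e0) \<bullet> e0 / \<alpha>) * exp (- \<delta> * (t - t0))" .
  qed
  ultimately show ?thesis by blast
qed

end
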